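(* Let $\textsf{AP}$ be a finite set of atomic propositions containing a proposition $p$. Then $\text{HyperLTL} \not\leq_{\textit{fin}} \text{KCTL}^*$; that is, there exists a HyperLTL sentence $\varphi$ over $\textsf{AP}$ such that for every finite set $\textsf{Agts}$ of agents, every observation map $\textit{Obs}:\textsf{Agts}\to 2^{\textsf{AP}}$ and every KCTL$^*$ sentence $\psi$ over $\textsf{Agts}$ and $\textsf{AP}$, there is a finite Kripke structure $K$ over $\textsf{AP}$ such that it is not the case that ($K\models\varphi$ iff $(K,\textit{Obs})\models\psi$).
   Context: A Kripke structure over $\textsf{AP}$ is $K=\langle S,s_0,E,V\rangle$ with state set $S$, initial state $s_0$, transition relation $E\subseteq S\times S$ such that every state has at least one successor, and valuation $V:S\to 2^{\textsf{AP}}$; it is finite if $S$ is finite. A path is an infinite sequence of states $t_0t_1\ldots$ with $(t_i,t_{i+1})\in E$; an initial path starts at $s_0$; $\pi[0,i]$ is the prefix up to position $i$. $V$ is extended to sequences of states pointwise. KCTL$^*$ (over a finite set $\textsf{Agts}$ of agents): $\varphi::=\top\mid p\mid\neg\varphi\mid\varphi\vee\varphi\mid \textsf{X}\varphi\mid\varphi\textsf{U}\varphi\mid\exists\varphi\mid \textsf{K}_a\varphi$ with $p\in\textsf{AP}$, $a\in\textsf{Agts}$; $\forall\varphi:=\neg\exists\neg\varphi$, $\textsf{F}\varphi:=\top\textsf{U}\varphi$, $\textsf{G}\varphi:=\neg\textsf{F}\neg\varphi$. A sentence is a formula in which every temporal or knowledge modality is in the scope of a path quantifier. An observation map is $\textit{Obs}:\textsf{Agts}\to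 2^{\textsf{AP}}$; two finite traces $w,w'\in(2^{\textsf{AP}})^*$ of equal length are $\textit{Obs}_a$-equivalent if $w(i)\cap\textit{Obs}(a)=w'(i)\cap\textit{Obs}(a)$ for all $i$. For an initial path $\pi$ of $K$ and $i\ge0$: $\pi,i\models p$ iff $p\in V(\pi(i))$; Boolean cases standard; $\pi,i\models\textsf{X}\varphi$ iff $\pi,i+1\models\varphi$; $\pi,i\models\varphi_1\textsf{U}\varphi_2$ iff for some $j\ge i$, $\pi,j\models\varphi_2$ and $\pi,k\models\varphi_1$ for all $k\in[i,j-1]$; $\pi,i\models\exists\varphi$ iff for some initial path $\pi'$ with $\pi'[0,i]=\pi[0,i]$, $\pi',i\models\varphi$; $\pi,i\models\textsf{K}_a\varphi$ iff for all initial paths $\pi'$ such that $V(\pi[0,i])$ and $V(\pi'[0,i])$ are $\textit{Obs}_a$-equivalent, $\pi',i\models\varphi$. $(K,\textit{Obs})\models\varphi$ iff $\pi,0\models\varphi$ for some initial path $\pi$. HyperCTL$^*$ (over a finite set $\textsf{VAR}$ of path variables): $\varphi::=\top\mid p[x]\mid\neg\varphi\mid\varphi\wedge\varphi\mid\textsf{X}\varphi\mid\varphi\textsf{U}\varphi\mid\exists x.\varphi$. Semantics w.r.t. a path assignment $\Pi$ mapping each variable to an initial path of $K$, a variable $y$ and a position $i$: $\Pi,y,i\models p[x]$ iff $p\in V(\Pi(x)(i))$; Boolean, $\textsf{X}$, $\textsf{U}$ as usual (on the position $i$); $\Pi,y,i\models\exists x.\varphi$ iff for some initial path $\pi$ with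 $\pi[0,i]=\Pi(y)[0,i]$, $\Pi[x\leftarrow\pi],x,i\models\varphi$. A sentence: every temporal modality in the scope of a quantifier and every variable in an atom $p[x]$ bound. $K\models\varphi$ iff $\Pi,y,0\models\varphi$ for some $\Pi,y$. HyperLTL is the fragment of sentences of the form $Q_1x_1.\cdots Q_nx_n.\psi$ with $Q_i\in\{\exists,\forall\}$ ($\forall x.\varphi:=\neg\exists x.\neg\varphi$) and $\psi$ quantifier-free. *)

theory Defs
  imports Main
begin

section \<open>Kripke structures and paths\<close>

record ('s, 'p) kripke =
  states :: "'s set"
  init :: 's
  trans :: "('s \<times> 's) set"
  val :: "'s \<Rightarrow> 'p set"

definition kripke_over :: "'p set \<Rightarrow> ('s, 'p) kripke \<Rightarrow> bool" where
  "kripke_over AP K \<longleftrightarrow>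
     init K \<in> states K \<and>
     trans K \<subseteq> states K \<times> states K \<and>
     (\<forall>s\<in>states K. \<exists>t. (s, t) \<in> trans K) \<and>
     (\<forall>s\<in>states K. val K s \<subseteq> AP)"

definition finite_kripke_over :: "'p set \<Rightarrow> ('s, 'p) kripke \<Rightarrow> bool" where
  "finite_kripke_over AP K \<longleftrightarrow> kripke_over AP K \<and> finite (states K)"

definition is_path :: "('s, 'p) kripke \<Rightarrow> (nat \<Rightarrow> 's) \<Rightarrow> bool" where
  "is_path K \<pi> \<longleftrightarrow> (\<forall>i. (\<pi> i, \<pi> (Suc i)) \<in> trans K)"

definition initial_path :: "('s, 'p) kripke \<Rightarrow> (nat \<Rightarrow> 's) \<Rightarrow> bool" where
  "initial_path K \<pi> \<longleftrightarrow> is_path K \<pi> \<and> \<pi> 0 = init K"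

text \<open>The prefix \<open>\<pi>[0,i]\<close>; it includes position \<open>i\<close>.\<close>

definition path_prefix :: "(nat \<Rightarrow> 's) \<Rightarrow> nat \<Rightarrow> 's list" where
  "path_prefix \<pi> i = map \<pi> [0..<Suc i]"

section \<open>KCTL*\<close>

datatype (kagents: 'a, kprops: 'p) kctl =
    KTop
  | KProp 'p
  | KNot "('a, 'p) kctl"
  | KOr "('a, 'p) kctl" "('a, 'p) kctl"
  | KNext "('a, 'p) kctl"
  | KUntil "('a, 'p) kctl" "('a, 'p) kctl"
  | KEx "('a, 'p) kctl"
  | Know 'a "('a, 'p) kctl"

primrec k_guarded :: "('a, 'p) kctl \<Rightarrow> bool" where
  "k_guarded KTop \<longleftrightarrow> True"
| "k_guarded (KProp p) \<longleftrightarrow> True"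
| "k_guarded (KNot \<phi>) \<longleftrightarrow> k_guarded \<phi>"
| "k_guarded (KOr \<phi> \<psi>) \<longleftrightarrow> k_guarded \<phi> \<and> k_guarded \<psi>"
| "k_guarded (KNext \<phi>) \<longleftrightarrow> False"
| "k_guarded (KUntil \<phi> \<psi>) \<longleftrightarrow> False"
| "k_guarded (KEx \<phi>) \<longleftrightarrow> True"
| "k_guarded (Know a \<phi>) \<longleftrightarrow> False"

definition kctl_sentence :: "'a set \<Rightarrow> 'p set \<Rightarrow> ('a, 'p) kctl \<Rightarrow> bool" where
  "kctl_sentence Agts AP \<psi> \<longleftrightarrow>
     kagents \<psi> \<subseteq> Agts \<and> kprops \<psi> \<subseteq> AP \<and> k_guarded \<psi>"

definition obs_equiv :: "'p set \<Rightarrow> 'p set list \<Rightarrow> 'p set list \<Rightarrow> bool" where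
  "obs_equiv Q w w' \<longleftrightarrow>
     length w = length w' \<and> (\<forall>i<length w. w ! i \<inter> Q = w' ! i \<inter> Q)"

primrec k_sat ::
  "('s, 'p) kripke \<Rightarrow> ('a \<Rightarrow> 'p set) \<Rightarrow> (nat \<Rightarrow> 's) \<Rightarrow> nat \<Rightarrow> ('a, 'p) kctl \<Rightarrow> bool" where
  "k_sat K Obs \<pi> i KTop \<longleftrightarrow> True"
| "k_sat K Obs \<pi> i (KProp p) \<longleftrightarrow> p \<in> val K (\<pi> i)"
| "k_sat K Obs \<pi> i (KNot \<phi>) \<longleftrightarrow> \<not> k_sat K Obs \<pi> i \<phi>"
| "k_sat K Obs \<pi> i (KOr \<phi> \<psi>) \<longleftrightarrow> k_sat K Obs \<pi> i \<phi> \<or> k_sat K Obs \<pi> i \<psi>"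
| "k_sat K Obs \<pi> i (KNext \<phi>) \<longleftrightarrow> k_sat K Obs \<pi> (Suc i) \<phi>"
| "k_sat K Obs \<pi> i (KUntil \<phi> \<psi>) \<longleftrightarrow>
     (\<exists>j\<ge>i. k_sat K Obs \<pi> j \<psi> \<and> (\<forall>k. i \<le> k \<and> k < j \<longrightarrow> k_sat K Obs \<pi> k \<phi>))"
| "k_sat K Obs \<pi> i (KEx \<phi>) \<longleftrightarrow>
     (\<exists>\<pi>'. initial_path K \<pi>' \<and> path_prefix \<pi>' i = path_prefix \<pi> i \<and> k_sat K Obs \<pi>' i \<phi>)"
| "k_sat K Obs \<pi> i (Know a \<phi>) \<longleftrightarrow>
     (\<forall>\<pi>'. initial_path K \<pi>' \<and>
        obs_equiv (Obs a) (map (val K) (path_prefix \<pi> i)) (map (val K) (path_prefix \<pi>' i)) \<longrightarrow>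
        k_sat K Obs \<pi>' i \<phi>)"

definition k_models :: "('s, 'p) kripke \<Rightarrow> ('a \<Rightarrow> 'p set) \<Rightarrow> ('a, 'p) kctl \<Rightarrow> bool" where
  "k_models K Obs \<psi> \<longleftrightarrow> (\<exists>\<pi>. initial_path K \<pi> \<and> k_sat K Obs \<pi> 0 \<psi>)"

section \<open>HyperCTL* and HyperLTL\<close>

text \<open>\<open>hvars\<close> collects all variables of a formula, those bound by a quantifier included.\<close>

datatype (hvars: 'x, hprops: 'p) hctl =
    HTop
  | HProp 'p 'x
  | HNot "('x, 'p) hctl"
  | HAnd "('x, 'p) hctl" "('x, 'p) hctl"
  | HNext "('x, 'p) hctl"
  | HUntil "('x, 'p) hctl" "('x, 'p) hctl"
  | HEx 'x "('x, 'p) hctl"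

definition HAll :: "'x \<Rightarrow> ('x, 'p) hctl \<Rightarrow> ('x, 'p) hctl" where
  "HAll x \<phi> = HNot (HEx x (HNot \<phi>))"

primrec h_free :: "('x, 'p) hctl \<Rightarrow> 'x set" where
  "h_free HTop = {}"
| "h_free (HProp p x) = {x}"
| "h_free (HNot \<phi>) = h_free \<phi>"
| "h_free (HAnd \<phi> \<psi>) = h_free \<phi> \<union> h_free \<psi>"
| "h_free (HNext \<phi>) = h_free \<phi>"
| "h_free (HUntil \<phi> \<psi>) = h_free \<phi> \<union> h_free \<psi>"
| "h_free (HEx x \<phi>) = h_free \<phi> - {x}"

primrec h_guarded :: "('x, 'p) hctl \<Rightarrow> bool" where
  "h_guarded HTop \<longleftrightarrow> True"
| "h_guarded (HProp p x) \<longleftrightarrow> True"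
| "h_guarded (HNot \<phi>) \<longleftrightarrow> h_guarded \<phi>"
| "h_guarded (HAnd \<phi> \<psi>) \<longleftrightarrow> h_guarded \<phi> \<and> h_guarded \<psi>"
| "h_guarded (HNext \<phi>) \<longleftrightarrow> False"
| "h_guarded (HUntil \<phi> \<psi>) \<longleftrightarrow> False"
| "h_guarded (HEx x \<phi>) \<longleftrightarrow> True"

definition hyperctl_sentence :: "'x set \<Rightarrow> 'p set \<Rightarrow> ('x, 'p) hctl \<Rightarrow> bool" where
  "hyperctl_sentence VAR AP \<phi> \<longleftrightarrow>
     hvars \<phi> \<subseteq> VAR \<and> hprops \<phi> \<subseteq> AP \<and> h_guarded \<phi> \<and> h_free \<phi> = {}"

primrec quantifier_free :: "('x, 'p) hctl \<Rightarrow> bool" where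
  "quantifier_free HTop \<longleftrightarrow> True"
| "quantifier_free (HProp p x) \<longleftrightarrow> True"
| "quantifier_free (HNot \<phi>) \<longleftrightarrow> quantifier_free \<phi>"
| "quantifier_free (HAnd \<phi> \<psi>) \<longleftrightarrow> quantifier_free \<phi> \<and> quantifier_free \<psi>"
| "quantifier_free (HNext \<phi>) \<longleftrightarrow> quantifier_free \<phi>"
| "quantifier_free (HUntil \<phi> \<psi>) \<longleftrightarrow> quantifier_free \<phi> \<and> quantifier_free \<psi>"
| "quantifier_free (HEx x \<phi>) \<longleftrightarrow> False"

inductive prenex :: "('x, 'p) hctl \<Rightarrow> bool" where
  matrix: "quantifier_free \<psi> \<Longrightarrow> prenex \<psi>"
| ex: "prenex \<phi> \<Longrightarrow> prenex (HEx x \<phi>)"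
| all: "prenex \<phi> \<Longrightarrow> prenex (HAll x \<phi>)"

definition hyperltl_sentence :: "'x set \<Rightarrow> 'p set \<Rightarrow> ('x, 'p) hctl \<Rightarrow> bool" where
  "hyperltl_sentence VAR AP \<phi> \<longleftrightarrow> hyperctl_sentence VAR AP \<phi> \<and> prenex \<phi>"

primrec h_sat ::
  "('s, 'p) kripke \<Rightarrow> ('x \<Rightarrow> nat \<Rightarrow> 's) \<Rightarrow> 'x \<Rightarrow> nat \<Rightarrow> ('x, 'p) hctl \<Rightarrow> bool" where
  "h_sat K \<Pi> y i HTop \<longleftrightarrow> True"
| "h_sat K \<Pi> y i (HProp p x) \<longleftrightarrow> p \<in> val K (\<Pi> x i)"
| "h_sat K \<Pi> y i (HNot \<phi>) \<longleftrightarrow> \<not> h_sat K \<Pi> y i \<phi>"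
| "h_sat K \<Pi> y i (HAnd \<phi> \<psi>) \<longleftrightarrow> h_sat K \<Pi> y i \<phi> \<and> h_sat K \<Pi> y i \<psi>"
| "h_sat K \<Pi> y i (HNext \<phi>) \<longleftrightarrow> h_sat K \<Pi> y (Suc i) \<phi>"
| "h_sat K \<Pi> y i (HUntil \<phi> \<psi>) \<longleftrightarrow>
     (\<exists>j\<ge>i. h_sat K \<Pi> y j \<psi> \<and> (\<forall>k. i \<le> k \<and> k < j \<longrightarrow> h_sat K \<Pi> y k \<phi>))"
| "h_sat K \<Pi> y i (HEx x \<phi>) \<longleftrightarrow>
     (\<exists>\<pi>. initial_path K \<pi> \<and> path_prefix \<pi> i = path_prefix (\<Pi> y) i \<and>
          h_sat K (\<Pi>(x := \<pi>)) x i \<phi>)"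

text \<open>Path assignments are total functions of which only the values on \<open>VAR\<close> matter.\<close>

definition h_models :: "'x set \<Rightarrow> ('s, 'p) kripke \<Rightarrow> ('x, 'p) hctl \<Rightarrow> bool" where
  "h_models VAR K \<phi> \<longleftrightarrow>
     (\<exists>\<Pi> y. (\<forall>x\<in>VAR. initial_path K (\<Pi> x)) \<and> y \<in> VAR \<and> h_sat K \<Pi> y 0 \<phi>)"

end

theory Submission
  imports Defs "HOL-Library.Nat_Bijection"
begin

text \<open>
  The sentence \<open>\<exists>x. \<exists>y. X p[x] \<and> X X p[y] \<and> X X X G (p[x] \<leftrightarrow> p[y])\<close> cannot be expressed.  Fix a period
  \<open>c\<close> and consider structures that are bundles of \<open>c + 2\<close> deterministic lassos leaving the initial
  state.  The trace of lasso \<open>\<alpha>\<close> first spells a one-hot code of \<open>\<alpha>\<close> and then runs through a shift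
  of the \<open>c\<close>-periodic word in which \<open>p\<close> holds exactly at the multiples of \<open>c\<close>.  Lassos \<open>2, \<dots>, c + 1\<close>
  realise all \<open>c\<close> shifts, lasso \<open>0\<close> has shift \<open>0\<close>, and lasso \<open>1\<close> has shift \<open>0\<close> in one structure and
  shift \<open>1\<close> in the other; only the first one satisfies the sentence.

  Once the code has been read, an agent observing \<open>p\<close> knows the lasso, and an agent not observing
  \<open>p\<close> sees the same set of shifts at every time.  So a KCTL* formula is from then on as good as an LTL
  formula, and an LTL formula of small depth cannot distinguish two positions that are both far
  from the next occurrence of \<open>p\<close>.  While the code is being read the two structures look the same.
\<close>

section \<open>Bundles of lassos\<close>

text \<open>A time is mapped to its vertex on a lasso with stem \<open>0..L\<close> and loop
  \<open>L+1..L+c\<close>.\<close>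

definition lasso_fold :: "nat \<Rightarrow> nat \<Rightarrow> nat \<Rightarrow> nat" where
  "lasso_fold L c t = (if t \<le> L then t else Suc L + (t - Suc L) mod c)"

text \<open>All lassos share the root \<open>0\<close>; \<open>Suc\<close> keeps it distinct from
  the encoded pairs of index and vertex, and the encoding makes states natural numbers.\<close>

definition lasso :: "nat \<Rightarrow> nat \<Rightarrow> nat \<Rightarrow> nat \<Rightarrow> nat" where
  "lasso L c \<alpha> t = (if t = 0 then 0 else Suc (prod_encode (\<alpha>, lasso_fold L c t)))"

definition lasso_bundle :: "'p \<Rightarrow> nat \<Rightarrow> nat \<Rightarrow> nat \<Rightarrow> (nat \<Rightarrow> nat \<Rightarrow> bool) \<Rightarrow> (nat, 'p) kripke" where
  "lasso_bundle p m L c P =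
     \<lparr>states = {lasso L c \<alpha> t | \<alpha> t. \<alpha> < m},
      init = 0,
      trans = {(lasso L c \<alpha> t, lasso L c \<alpha> (Suc t)) | \<alpha> t. \<alpha> < m},
      val = (\<lambda>s. if \<exists>\<alpha> t. s = lasso L c \<alpha> t \<and> P \<alpha> t then {p} else {})\<rparr>"

lemma lasso_fold_le: "c > 0 \<Longrightarrow> lasso_fold L c t \<le> L + c"
  by (auto simp: lasso_fold_def Suc_le_eq)

text \<open>The next vertex depends only on the current vertex, not on how often the loop was
  traversed; this makes each lasso deterministic.\<close>

lemma lasso_fold_Suc: "lasso_fold L c (Suc t) = lasso_fold L c (Suc (lasso_fold L c t))"
proof (cases "t \<le> L")
  case False
  then have "t - L = Suc (t - Suc L)" by simp
  with False show ?thesis by (simp add: lasso_fold_def mod_Suc_eq)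
qed (simp add: lasso_fold_def)

lemma lasso_eq_iff:
  "lasso L c \<alpha> t = lasso L c \<beta> u \<longleftrightarrow>
     t = 0 \<and> u = 0 \<or> t > 0 \<and> u > 0 \<and> \<alpha> = \<beta> \<and> lasso_fold L c t = lasso_fold L c u"
  by (auto simp: lasso_def)

lemma path_prefix_eq_iff: "path_prefix \<pi> i = path_prefix \<pi>' i \<longleftrightarrow> (\<forall>j\<le>i. \<pi> j = \<pi>' j)"
  by (auto simp: path_prefix_def)

lemma path_prefix_lasso_eq_iff:
  "path_prefix (lasso L c \<alpha>) i = path_prefix (lasso L c \<beta>) i \<longleftrightarrow> i = 0 \<or> \<alpha> = \<beta>"
  unfolding path_prefix_eq_iff lasso_eq_iff by auto

lemma finite_kripke_over_bundle:
  assumes "m > 0" "c > 0" "p \<in> AP"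
  shows "finite_kripke_over AP (lasso_bundle p m L c P)"
proof -
  have "{lasso L c \<alpha> t | \<alpha> t. \<alpha> < m}
      \<subseteq> insert 0 ((\<lambda>x. Suc (prod_encode x)) ` ({..<m} \<times> {..L + c}))"
    using lasso_fold_le[OF assms(2)] by (auto simp: lasso_def)
  then have "finite {lasso L c \<alpha> t | \<alpha> t. \<alpha> < m}"
    by (rule finite_subset) auto
  moreover have "0 = lasso L c 0 0"
    by (simp add: lasso_def)
  ultimately show ?thesis
    using assms unfolding finite_kripke_over_def kripke_over_def lasso_bundle_def
    by auto
qed

text \<open>Branching occurs only at the root. The first step fixes the index, and from then on
  every state has a unique successor.\<close>

lemma initial_path_bundle_iff:
  "initial_path (lasso_bundle p m L c P) \<pi> \<longleftrightarrow> (\<exists>\<alpha><m. \<pi> = lasso L c \<alpha>)"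
proof
  assume "\<exists>\<alpha><m. \<pi> = lasso L c \<alpha>"
  then show "initial_path (lasso_bundle p m L c P) \<pi>"
    by (auto simp: initial_path_def is_path_def lasso_bundle_def lasso_def[of _ _ _ 0])
next
  assume path: "initial_path (lasso_bundle p m L c P) \<pi>"
  then have \<pi>0: "\<pi> 0 = 0"
    by (simp add: initial_path_def lasso_bundle_def)
  have step: "\<exists>\<alpha> u. \<alpha> < m \<and> \<pi> t = lasso L c \<alpha> u \<and> \<pi> (Suc t) = lasso L c \<alpha> (Suc u)" for t
    using path unfolding initial_path_def is_path_def lasso_bundle_def by simp blast
  obtain \<alpha> where \<alpha>: "\<alpha> < m" "\<pi> 1 = lasso L c \<alpha> 1"
    using step[of 0] \<pi>0 by (auto simp: lasso_def split: if_splits)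
  \<comment> \<open>The induction starts at time 1, because the root does not reveal the index. The
    time \<open>u\<close> supplied by a transition may differ from \<open>Suc t\<close>; only their
    folds agree.\<close>
  have "\<pi> (Suc t) = lasso L c \<alpha> (Suc t)" for t
  proof (induction t)
    case 0
    then show ?case using \<alpha> by simp
  next
    case (Suc t)
    obtain \<beta> u where u: "\<pi> (Suc t) = lasso L c \<beta> u" "\<pi> (Suc (Suc t)) = lasso L c \<beta> (Suc u)"
      using step[of "Suc t"] by auto
    then have "\<alpha> = \<beta>" "lasso_fold L c (Suc t) = lasso_fold L c u"
      using Suc by (auto simp: lasso_eq_iff)
    then have "lasso_fold L c (Suc (Suc t)) = lasso_fold L c (Suc u)"
      by (metis lasso_fold_Suc)
    with u \<open>\<alpha> = \<beta>\<close> show ?case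
      by (simp add: lasso_eq_iff)
  qed
  then have "\<pi> t = lasso L c \<alpha> t" for t
    by (cases t) (auto simp: \<pi>0 lasso_def[of _ _ _ 0])
  with \<alpha> show "\<exists>\<alpha><m. \<pi> = lasso L c \<alpha>"
    by auto
qed

text \<open>This makes \<open>P\<close> a function of states: every trace has the same value at the
  shared root and is periodic on the loop.\<close>

definition lasso_shaped :: "nat \<Rightarrow> nat \<Rightarrow> (nat \<Rightarrow> nat \<Rightarrow> bool) \<Rightarrow> bool" where
  "lasso_shaped L c P \<longleftrightarrow> (\<forall>\<alpha>. \<not> P \<alpha> 0) \<and> (\<forall>\<alpha> t. t > L \<longrightarrow> P \<alpha> (t + c) = P \<alpha> t)"

lemma lasso_shaped_fold:
  assumes "lasso_shaped L c P"
  shows "P \<alpha> (lasso_fold L c t) = P \<alpha> t"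
proof (cases "t \<le> L")
  case False
  have per: "u > L \<Longrightarrow> P \<alpha> (u + k * c) = P \<alpha> u" for u k
  proof (induction k)
    case (Suc k)
    have "P \<alpha> ((u + k * c) + c) = P \<alpha> (u + k * c)"
      using assms Suc.prems by (simp add: lasso_shaped_def)
    with Suc show ?case by (simp add: algebra_simps)
  qed simp
  have "t = lasso_fold L c t + (t - Suc L) div c * c"
    using False by (simp add: lasso_fold_def)
  moreover have "lasso_fold L c t > L"
    using False by (simp add: lasso_fold_def)
  ultimately show ?thesis
    by (metis per)
qed (simp add: lasso_fold_def)

lemma val_bundle:
  assumes "lasso_shaped L c P"
  shows "val (lasso_bundle p m L c P) (lasso L c \<alpha> t) = (if P \<alpha> t then {p} else {})"
proof -
  have "P \<alpha> t" if "lasso L c \<alpha> t = lasso L c \<beta> u" "P \<beta> u" for \<beta> u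
    using that assms lasso_shaped_fold[OF assms, of \<alpha> t] lasso_shaped_fold[OF assms, of \<alpha> u]
    by (auto simp: lasso_eq_iff lasso_shaped_def)
  then show ?thesis
    by (auto simp: lasso_bundle_def)
qed

text \<open>Paths are replaced by lasso indices. Distinct lassos share only the root, whence the
  test \<open>i = 0\<close> in the case \<open>KEx\<close>; labels contain at most \<open>p\<close>,
  so an agent sees either \<open>p\<close> or nothing.\<close>

primrec trace_sat ::
  "'p \<Rightarrow> nat \<Rightarrow> (nat \<Rightarrow> nat \<Rightarrow> bool) \<Rightarrow> ('a \<Rightarrow> 'p set) \<Rightarrow> nat \<Rightarrow> nat \<Rightarrow> ('a, 'p) kctl \<Rightarrow> bool" where
  "trace_sat p m P Obs \<alpha> i KTop \<longleftrightarrow> True"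
| "trace_sat p m P Obs \<alpha> i (KProp q) \<longleftrightarrow> q = p \<and> P \<alpha> i"
| "trace_sat p m P Obs \<alpha> i (KNot \<phi>) \<longleftrightarrow> \<not> trace_sat p m P Obs \<alpha> i \<phi>"
| "trace_sat p m P Obs \<alpha> i (KOr \<phi> \<psi>) \<longleftrightarrow> trace_sat p m P Obs \<alpha> i \<phi> \<or> trace_sat p m P Obs \<alpha> i \<psi>"
| "trace_sat p m P Obs \<alpha> i (KNext \<phi>) \<longleftrightarrow> trace_sat p m P Obs \<alpha> (Suc i) \<phi>"
| "trace_sat p m P Obs \<alpha> i (KUntil \<phi> \<psi>) \<longleftrightarrow>
     (\<exists>j\<ge>i. trace_sat p m P Obs \<alpha> j \<psi> \<and> (\<forall>k. i \<le> k \<and> k < j \<longrightarrow> trace_sat p m P Obs \<alpha> k \<phi>))"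
| "trace_sat p m P Obs \<alpha> i (KEx \<phi>) \<longleftrightarrow>
     (\<exists>\<beta><m. (i = 0 \<or> \<alpha> = \<beta>) \<and> trace_sat p m P Obs \<beta> i \<phi>)"
| "trace_sat p m P Obs \<alpha> i (Know a \<phi>) \<longleftrightarrow>
     (\<forall>\<beta><m. (p \<in> Obs a \<longrightarrow> (\<forall>j\<le>i. P \<alpha> j = P \<beta> j)) \<longrightarrow> trace_sat p m P Obs \<beta> i \<phi>)"

lemma obs_equiv_bundle:
  fixes m :: nat
  assumes "lasso_shaped L c P"
  shows "obs_equiv Q (map (val (lasso_bundle p m L c P)) (path_prefix (lasso L c \<alpha>) i))
                     (map (val (lasso_bundle p m L c P)) (path_prefix (lasso L c \<beta>) i)) \<longleftrightarrow>
         (p \<in> Q \<longrightarrow> (\<forall>j\<le>i. P \<alpha> j = P \<beta> j))"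
proof -
  have nth: "map (val (lasso_bundle p m L c P)) (path_prefix (lasso L c \<gamma>) i) ! j
      = (if P \<gamma> j then {p} else {})" if "j \<le> i" for \<gamma> j
    using that by (simp add: path_prefix_def val_bundle[OF assms] del: upt_Suc)
  have len: "length (map (val (lasso_bundle p m L c P)) (path_prefix (lasso L c \<gamma>) i)) = Suc i" for \<gamma>
    by (simp add: path_prefix_def)
  have "obs_equiv Q (map (val (lasso_bundle p m L c P)) (path_prefix (lasso L c \<alpha>) i))
                     (map (val (lasso_bundle p m L c P)) (path_prefix (lasso L c \<beta>) i)) \<longleftrightarrow>
      (\<forall>j\<le>i. (if P \<alpha> j then {p} else {}) \<inter> Q = (if P \<beta> j then {p} else {}) \<inter> Q)"
    unfolding obs_equiv_def len by (auto simp: less_Suc_eq_le nth)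
  then show ?thesis
    by (auto split: if_splits)
qed

lemma k_sat_bundle:
  assumes "lasso_shaped L c P"
  shows "k_sat (lasso_bundle p m L c P) Obs (lasso L c \<alpha>) i \<phi> \<longleftrightarrow> trace_sat p m P Obs \<alpha> i \<phi>"
proof (induction \<phi> arbitrary: \<alpha> i)
  case (KProp q)
  then show ?case by (simp add: val_bundle[OF assms])
next
  case (KEx \<phi>)
  then show ?case
    by (simp add: initial_path_bundle_iff) (metis path_prefix_lasso_eq_iff)
next
  case (Know a \<phi>)
  have "k_sat (lasso_bundle p m L c P) Obs (lasso L c \<alpha>) i (Know a \<phi>) \<longleftrightarrow>
    (\<forall>\<beta><m. obs_equiv (Obs a) (map (val (lasso_bundle p m L c P)) (path_prefix (lasso L c \<alpha>) i))
                     (map (val (lasso_bundle p m L c P)) (path_prefix (lasso L c \<beta>) i)) \<longrightarrow>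
        k_sat (lasso_bundle p m L c P) Obs (lasso L c \<beta>) i \<phi>)"
    by (auto simp: initial_path_bundle_iff)
  then show ?case
    unfolding obs_equiv_bundle[OF assms] Know.IH by simp
qed simp_all

lemma k_models_bundle:
  assumes "lasso_shaped L c P"
  shows "k_models (lasso_bundle p m L c P) Obs \<phi> \<longleftrightarrow> (\<exists>\<alpha><m. trace_sat p m P Obs \<alpha> 0 \<phi>)"
  unfolding k_models_def initial_path_bundle_iff
  by (auto simp: k_sat_bundle[OF assms])

section \<open>KCTL* on a periodic word\<close>

text \<open>This is the semantics once the code has been read: the path is determined, and an agent
  either knows the position or considers every position possible.\<close>

primrec cycle_sat :: "'p \<Rightarrow> nat \<Rightarrow> ('a \<Rightarrow> 'p set) \<Rightarrow> nat \<Rightarrow> ('a, 'p) kctl \<Rightarrow> bool" where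
  "cycle_sat p c Obs n KTop \<longleftrightarrow> True"
| "cycle_sat p c Obs n (KProp q) \<longleftrightarrow> q = p \<and> c dvd n"
| "cycle_sat p c Obs n (KNot \<phi>) \<longleftrightarrow> \<not> cycle_sat p c Obs n \<phi>"
| "cycle_sat p c Obs n (KOr \<phi> \<psi>) \<longleftrightarrow> cycle_sat p c Obs n \<phi> \<or> cycle_sat p c Obs n \<psi>"
| "cycle_sat p c Obs n (KNext \<phi>) \<longleftrightarrow> cycle_sat p c Obs (Suc n) \<phi>"
| "cycle_sat p c Obs n (KUntil \<phi> \<psi>) \<longleftrightarrow>
     (\<exists>j. cycle_sat p c Obs (n + j) \<psi> \<and> (\<forall>k<j. cycle_sat p c Obs (n + k) \<phi>))"
| "cycle_sat p c Obs n (KEx \<phi>) \<longleftrightarrow> cycle_sat p c Obs n \<phi>"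
| "cycle_sat p c Obs n (Know a \<phi>) \<longleftrightarrow>
     (if p \<in> Obs a then cycle_sat p c Obs n \<phi> else (\<forall>n'. cycle_sat p c Obs n' \<phi>))"

text \<open>Atoms have depth 1, so that a formula of depth \<open>d\<close> only inspects the next \<open>d\<close> positions
  of a block of \<open>\<not> p\<close>.\<close>

primrec next_depth :: "('a, 'p) kctl \<Rightarrow> nat" where
  "next_depth KTop = 0"
| "next_depth (KProp q) = 1"
| "next_depth (KNot \<phi>) = next_depth \<phi>"
| "next_depth (KOr \<phi> \<psi>) = max (next_depth \<phi>) (next_depth \<psi>)"
| "next_depth (KNext \<phi>) = Suc (next_depth \<phi>)"
| "next_depth (KUntil \<phi> \<psi>) = max (next_depth \<phi>) (next_depth \<psi>)"
| "next_depth (KEx \<phi>) = next_depth \<phi>"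
| "next_depth (Know a \<phi>) = next_depth \<phi>"

lemma cycle_sat_add_period: "cycle_sat p c Obs (n + c) \<phi> \<longleftrightarrow> cycle_sat p c Obs n \<phi>"
proof (induction \<phi> arbitrary: n)
  case (KNext \<phi>)
  then show ?case using KNext[of "Suc n"] by simp
next
  case (KUntil \<phi> \<psi>)
  have "n + c + j = (n + j) + c" for j by simp
  then show ?case by (simp only: cycle_sat.simps KUntil)
qed simp_all

lemma cycle_sat_mod_cong:
  assumes "n mod c = n' mod c"
  shows "cycle_sat p c Obs n \<phi> \<longleftrightarrow> cycle_sat p c Obs n' \<phi>"
proof -
  have *: "cycle_sat p c Obs (u + k * c) \<phi> = cycle_sat p c Obs u \<phi>" for u k
  proof (induction k)
    case (Suc k)
    then show ?case
      using cycle_sat_add_period[of p c Obs "u + k * c" \<phi>] by (simp add: algebra_simps)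
  qed simp
  show ?thesis
    using *[of "n mod c" "n div c"] *[of "n' mod c" "n' div c"]
    by (simp only: mod_div_mult_eq) (simp only: assms)
qed

lemma cycle_sat_KUntil_unfold:
  "cycle_sat p c Obs n (KUntil \<phi> \<psi>) \<longleftrightarrow>
     cycle_sat p c Obs n \<psi> \<or>
     cycle_sat p c Obs n \<phi> \<and> cycle_sat p c Obs (Suc n) (KUntil \<phi> \<psi>)" (is "?l \<longleftrightarrow> ?r")
proof
  assume ?l
  then obtain j where j: "cycle_sat p c Obs (n + j) \<psi>" "\<forall>k<j. cycle_sat p c Obs (n + k) \<phi>"
    by auto
  show ?r
  proof (cases j)
    case (Suc l)
    have "cycle_sat p c Obs (Suc n + k) \<phi>" if "k < l" for k
      using j(2)[rule_format, of "Suc k"] that Suc by simp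
    then show ?thesis
      using j Suc by auto
  qed (use j in simp)
next
  assume ?r
  then show ?l
  proof
    assume "cycle_sat p c Obs n \<psi>"
    then show ?l by (auto intro!: exI[of _ 0])
  next
    assume *: "cycle_sat p c Obs n \<phi> \<and> cycle_sat p c Obs (Suc n) (KUntil \<phi> \<psi>)"
    then obtain j where j: "cycle_sat p c Obs (n + Suc j) \<psi>"
      "\<forall>k<j. cycle_sat p c Obs (n + Suc k) \<phi>" by auto
    have "cycle_sat p c Obs (n + k) \<phi>" if "k < Suc j" for k
      using that * j by (cases k) auto
    with j(1) show ?l by (auto intro!: exI[of _ "Suc j"])
  qed
qed

text \<open>The bound keeps both positions, with their lookahead, inside a block without
  \<open>p\<close>. An until costs no depth: its arguments agree at \<open>n\<close> and
  \<open>Suc n\<close>, so unfolding it once at each position shows that it agrees there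
  too.\<close>

lemma cycle_sat_Suc:
  assumes "0 < n" "Suc n + next_depth \<phi> \<le> c"
  shows "cycle_sat p c Obs (Suc n) \<phi> \<longleftrightarrow> cycle_sat p c Obs n \<phi>"
  using assms
proof (induction \<phi> arbitrary: n)
  case (KProp q)
  then show ?case by (auto dest: dvd_imp_le)
next
  case (KUntil \<phi> \<psi>)
  have "cycle_sat p c Obs (Suc n) \<phi> = cycle_sat p c Obs n \<phi>"
    "cycle_sat p c Obs (Suc n) \<psi> = cycle_sat p c Obs n \<psi>"
    using KUntil by auto
  then show ?case
    using cycle_sat_KUntil_unfold[of p c Obs n \<phi> \<psi>]
      cycle_sat_KUntil_unfold[of p c Obs "Suc n" \<phi> \<psi>]
    by blast
qed auto

section \<open>The two structures\<close>

text \<open>Positions \<open>1..c+2\<close> carry one code bit per lasso; the periodic part is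
  entered at time \<open>c+3\<close>, at position \<open>1 + off \<alpha>\<close> of the
  cycle.\<close>

definition coded_trace :: "nat \<Rightarrow> (nat \<Rightarrow> nat) \<Rightarrow> nat \<Rightarrow> nat \<Rightarrow> bool" where
  "coded_trace c off \<alpha> t = (if t \<le> c + 2 then t = Suc \<alpha> else c dvd t - (c + 2) + off \<alpha>)"

definition all_shifts :: "nat \<Rightarrow> (nat \<Rightarrow> nat) \<Rightarrow> bool" where
  "all_shifts c off \<longleftrightarrow> (\<forall>k<c. off (k + 2) = k)"

lemma lasso_shaped_coded_trace: "lasso_shaped (c + 2) c (coded_trace c off)"
proof -
  have "c dvd t + c - (c + 2) + off \<alpha> \<longleftrightarrow> c dvd t - (c + 2) + off \<alpha>" if "t > c + 2" for t \<alpha>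
  proof -
    have "t + c - (c + 2) + off \<alpha> = (t - (c + 2) + off \<alpha>) + c"
      using that by simp
    then show ?thesis by (metis dvd_add_triv_right_iff)
  qed
  then show ?thesis
    by (simp add: lasso_shaped_def coded_trace_def)
qed

lemma coded_trace_prefix_inj:
  assumes "\<alpha> < c + 2" "c + 2 \<le> i" "\<forall>j\<le>i. coded_trace c off \<alpha> j = coded_trace c off \<beta> j"
  shows "\<alpha> = \<beta>"
proof -
  have "coded_trace c off \<alpha> (Suc \<alpha>) = coded_trace c off \<beta> (Suc \<alpha>)"
    using assms by simp
  then show ?thesis
    using assms(1) by (simp add: coded_trace_def)
qed

text \<open>The code identifies the lasso to observers of \<open>p\<close>. For other agents, the
  lassos \<open>2..c+1\<close> occupy all residues modulo \<open>c\<close> at any time, so their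
  knowledge ranges over the whole cycle.\<close>

lemma trace_sat_after_code:
  assumes "all_shifts c off" "c > 0" "i > c + 2" "\<alpha> < c + 2"
  shows "trace_sat p (c + 2) (coded_trace c off) Obs \<alpha> i \<phi> \<longleftrightarrow>
         cycle_sat p c Obs (i - (c + 2) + off \<alpha>) \<phi>"
  using assms(3,4)
proof (induction \<phi> arbitrary: \<alpha> i)
  case (KProp q)
  then show ?case by (simp add: coded_trace_def)
next
  case (KNext \<phi>)
  have "Suc i - (c + 2) + off \<alpha> = Suc (i - (c + 2) + off \<alpha>)"
    using KNext.prems by simp
  then show ?case using KNext by (metis cycle_sat.simps(5) less_SucI trace_sat.simps(5))
next
  case (KUntil \<phi> \<psi>)
  have shift: "trace_sat p (c + 2) (coded_trace c off) Obs \<alpha> (i + j) \<chi> =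
      cycle_sat p c Obs (i - (c + 2) + off \<alpha> + j) \<chi>" if "\<chi> \<in> {\<phi>, \<psi>}" for \<chi> j
  proof -
    have "i + j - (c + 2) + off \<alpha> = i - (c + 2) + off \<alpha> + j"
      using KUntil.prems by simp
    then show ?thesis
      using that KUntil by (metis insertE singletonD trans_less_add1)
  qed
  have "trace_sat p (c + 2) (coded_trace c off) Obs \<alpha> i (KUntil \<phi> \<psi>) \<longleftrightarrow>
    (\<exists>j. trace_sat p (c + 2) (coded_trace c off) Obs \<alpha> (i + j) \<psi> \<and>
       (\<forall>k<j. trace_sat p (c + 2) (coded_trace c off) Obs \<alpha> (i + k) \<phi>))" (is "?l \<longleftrightarrow> ?r")
  proof
    assume ?l
    then obtain j where "j \<ge> i" "trace_sat p (c + 2) (coded_trace c off) Obs \<alpha> j \<psi>"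
      "\<forall>k. i \<le> k \<and> k < j \<longrightarrow> trace_sat p (c + 2) (coded_trace c off) Obs \<alpha> k \<phi>" by auto
    then show ?r by (intro exI[of _ "j - i"]) auto
  next
    assume ?r
    then obtain j where j: "trace_sat p (c + 2) (coded_trace c off) Obs \<alpha> (i + j) \<psi>"
      "\<forall>k<j. trace_sat p (c + 2) (coded_trace c off) Obs \<alpha> (i + k) \<phi>" by auto
    have "trace_sat p (c + 2) (coded_trace c off) Obs \<alpha> k \<phi>" if "i \<le> k" "k < i + j" for k
      using that j(2)[rule_format, of "k - i"] by simp
    with j(1) show ?l by (auto intro!: exI[of _ "i + j"])
  qed
  also have "\<dots> \<longleftrightarrow> cycle_sat p c Obs (i - (c + 2) + off \<alpha>) (KUntil \<phi> \<psi>)"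
    using shift[of \<phi>] shift[of \<psi>] by (simp del: add_2_eq_Suc')
  finally show ?case .
next
  case (KEx \<phi>)
  then show ?case by auto
next
  case (Know a \<phi>)
  show ?case
  proof (cases "p \<in> Obs a")
    case True
    have "(\<forall>j\<le>i. coded_trace c off \<alpha> j = coded_trace c off \<beta> j) \<longleftrightarrow> \<beta> = \<alpha>" for \<beta>
      using coded_trace_prefix_inj[of \<alpha> c i off \<beta>] Know.prems by auto
    then show ?thesis
      using True Know by simp
  next
    case False
    have "\<exists>\<beta><c + 2. cycle_sat p c Obs (i - (c + 2) + off \<beta>) \<phi> = cycle_sat p c Obs n \<phi>" for n
    proof -
      define x where "x = i - (c + 2)"
      \<comment> \<open>The shift \<open>k\<close> solves \<open>x + k = n\<close> modulo
        \<open>c\<close>; adding \<open>c - x mod c\<close> subtracts \<open>x\<close> without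
        truncation.\<close>
      define k where "k = (n + (c - x mod c)) mod c"
      have k: "k < c" using assms(2) by (simp add: k_def)
      have "(x + k) mod c = (x mod c + (n + (c - x mod c))) mod c"
        unfolding k_def by (simp add: mod_simps)
      also have "x mod c + (n + (c - x mod c)) = n + c"
        using mod_less_divisor[OF assms(2), of x] by linarith
      finally have "(x + k) mod c = n mod c" by simp
      then have "cycle_sat p c Obs (x + k) \<phi> = cycle_sat p c Obs n \<phi>"
        by (rule cycle_sat_mod_cong)
      with k assms(1) show ?thesis
        by (intro exI[of _ "k + 2"]) (simp add: all_shifts_def x_def)
    qed
    then have "(\<forall>\<beta><c + 2. cycle_sat p c Obs (i - (c + 2) + off \<beta>) \<phi>) \<longleftrightarrow>
        (\<forall>n. cycle_sat p c Obs n \<phi>)"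
      by blast
    then show ?thesis
      using False Know by simp
  qed
qed simp_all

section \<open>Indistinguishability of structures with similar shifts\<close>

lemma trace_sat_KUntil_unfold:
  "trace_sat p m P Obs \<alpha> i (KUntil \<phi> \<psi>) \<longleftrightarrow>
     trace_sat p m P Obs \<alpha> i \<psi> \<or>
     trace_sat p m P Obs \<alpha> i \<phi> \<and> trace_sat p m P Obs \<alpha> (Suc i) (KUntil \<phi> \<psi>)" (is "?l \<longleftrightarrow> ?r")
proof
  assume ?l
  then obtain j where j: "j \<ge> i" "trace_sat p m P Obs \<alpha> j \<psi>"
    "\<forall>k. i \<le> k \<and> k < j \<longrightarrow> trace_sat p m P Obs \<alpha> k \<phi>" by auto
  show ?r
  proof (cases "j = i")
    case False
    with j have "trace_sat p m P Obs \<alpha> i \<phi>" "Suc i \<le> j" by auto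
    with j show ?thesis by auto
  qed (use j in simp)
next
  assume ?r
  then show ?l
  proof
    assume "trace_sat p m P Obs \<alpha> i \<psi>"
    then show ?l by auto
  next
    assume *: "trace_sat p m P Obs \<alpha> i \<phi> \<and> trace_sat p m P Obs \<alpha> (Suc i) (KUntil \<phi> \<psi>)"
    then obtain j where j: "j \<ge> Suc i" "trace_sat p m P Obs \<alpha> j \<psi>"
      "\<forall>k. Suc i \<le> k \<and> k < j \<longrightarrow> trace_sat p m P Obs \<alpha> k \<phi>" by auto
    have "trace_sat p m P Obs \<alpha> k \<phi>" if "i \<le> k" "k < j" for k
      using that * j by (cases "k = i") auto
    with j show ?l by (auto intro!: exI[of _ j])
  qed
qed

text \<open>Shifts 0 and 1 enter the cycle at positions 1 and 2, the pair compared by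
  \<open>cycle_sat_Suc\<close> with \<open>n = 1\<close>.\<close>

definition similar_shifts :: "nat \<Rightarrow> (nat \<Rightarrow> nat) \<Rightarrow> (nat \<Rightarrow> nat) \<Rightarrow> bool" where
  "similar_shifts c off off' \<longleftrightarrow>
     (\<forall>\<alpha><c + 2. off \<alpha> = off' \<alpha> \<or> {off \<alpha>, off' \<alpha>} = {0, 1})"

text \<open>Up to time \<open>c+2\<close> the traces coincide, so the claim passes through the
  connectives. At \<open>c+3\<close> whole formulas are compared on the cycle; the argument never
  looks at later times, where the traces may differ.\<close>

lemma trace_sat_similar_shifts:
  assumes "all_shifts c off" "all_shifts c off'" "similar_shifts c off off'"
    and "next_depth \<phi> + 2 \<le> c" "i \<le> c + 3" "\<alpha> < c + 2"
  shows "trace_sat p (c + 2) (coded_trace c off) Obs \<alpha> i \<phi> \<longleftrightarrow>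
         trace_sat p (c + 2) (coded_trace c off') Obs \<alpha> i \<phi>"
  using assms(4-6)
proof (induction \<phi> arbitrary: i \<alpha>)
  let ?s = "trace_sat p (c + 2) (coded_trace c off) Obs"
  let ?s' = "trace_sat p (c + 2) (coded_trace c off') Obs"
  have entry: "?s \<alpha> (c + 3) \<phi> = ?s' \<alpha> (c + 3) \<phi>" if "next_depth \<phi> + 2 \<le> c" "\<alpha> < c + 2" for \<alpha> \<phi>
  proof -
    have "cycle_sat p c Obs (1 + off \<alpha>) \<phi> = cycle_sat p c Obs (1 + off' \<alpha>) \<phi>"
      using cycle_sat_Suc[of 1 \<phi> c p Obs] that assms(3)
      by (auto simp: similar_shifts_def doubleton_eq_iff)
    then show ?thesis
      using trace_sat_after_code[OF assms(1), of "c + 3" \<alpha> p Obs \<phi>]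
        trace_sat_after_code[OF assms(2), of "c + 3" \<alpha> p Obs \<phi>] that by simp
  qed
  have code: "coded_trace c off \<alpha> i = coded_trace c off' \<alpha> i" if "i \<le> c + 2" for i \<alpha>
    using that by (simp add: coded_trace_def)
  {
    case (KProp q)
    then show ?case
      using entry[of "KProp q" \<alpha>] code[of i \<alpha>] by (cases "i = c + 3") auto
  next
    case (KNext \<phi>)
    then show ?case
      using entry[of "KNext \<phi>" \<alpha>] KNext.IH[of "Suc i" \<alpha>] by (cases "i = c + 3") auto
  next
    case (KUntil \<phi> \<psi>)
    \<comment> \<open>Backward induction from the entry into the cycle, by one-step unfolding,
      avoids until witnesses that lie beyond \<open>c+3\<close>.\<close>
    from \<open>i \<le> c + 3\<close> show ?case
    proof (induction i rule: inc_induct)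
      case base
      show ?case by (rule entry) (use KUntil.prems in auto)
    next
      case (step n)
      have "?s \<alpha> n \<phi> = ?s' \<alpha> n \<phi>" "?s \<alpha> n \<psi> = ?s' \<alpha> n \<psi>"
        using KUntil.IH[of n \<alpha>] KUntil.prems step by auto
      then show ?case
        using step.IH trace_sat_KUntil_unfold by metis
    qed
  next
    case (KEx \<phi>)
    then show ?case by auto
  next
    case (Know a \<phi>)
    show ?case
    proof (cases "i = c + 3")
      case True
      then show ?thesis using entry[of "Know a \<phi>" \<alpha>] Know.prems by blast
    next
      case False
      then have "coded_trace c off \<beta> j = coded_trace c off' \<beta> j" if "j \<le> i" for \<beta> j
        using that Know.prems by (intro code) auto
      then show ?thesis
        using Know by auto
    qed
  }
qed auto

section \<open>The sentence\<close>

definition HGlobally :: "('x, 'p) hctl \<Rightarrow> ('x, 'p) hctl" where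
  "HGlobally \<phi> = HNot (HUntil HTop (HNot \<phi>))"

definition HIff :: "('x, 'p) hctl \<Rightarrow> ('x, 'p) hctl \<Rightarrow> ('x, 'p) hctl" where
  "HIff \<phi> \<psi> = HAnd (HNot (HAnd \<phi> (HNot \<psi>))) (HNot (HAnd \<psi> (HNot \<phi>)))"

lemma h_sat_HGlobally: "h_sat K \<Pi> y i (HGlobally \<phi>) \<longleftrightarrow> (\<forall>j\<ge>i. h_sat K \<Pi> y j \<phi>)"
  by (auto simp: HGlobally_def)

lemma h_sat_HIff:
  "h_sat K \<Pi> y i (HIff \<phi> \<psi>) \<longleftrightarrow> (h_sat K \<Pi> y i \<phi> \<longleftrightarrow> h_sat K \<Pi> y i \<psi>)"
  by (auto simp: HIff_def)

definition merging_sentence :: "'p \<Rightarrow> (nat, 'p) hctl" where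
  "merging_sentence p = HEx 0 (HEx 1
     (HAnd (HNext (HProp p 0))
       (HAnd (HNext (HNext (HProp p 1)))
         (HNext (HNext (HNext (HGlobally (HIff (HProp p 0) (HProp p 1)))))))))"

lemma hyperltl_sentence_merging:
  assumes "p \<in> AP"
  shows "hyperltl_sentence {0, 1} AP (merging_sentence p)"
  unfolding hyperltl_sentence_def hyperctl_sentence_def merging_sentence_def
  using assms by (auto simp: HGlobally_def HIff_def intro!: prenex.intros)

lemma h_models_merging_bundle:
  assumes "lasso_shaped L c P" "m > 0"
  shows "h_models {0, 1} (lasso_bundle p m L c P) (merging_sentence p) \<longleftrightarrow>
    (\<exists>\<alpha><m. \<exists>\<beta><m. P \<alpha> 1 \<and> P \<beta> 2 \<and> (\<forall>t\<ge>3. P \<alpha> t = P \<beta> t))"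
proof -
  let ?K = "lasso_bundle p m L c P"
  \<comment> \<open>Quantification at position 0 is unrestricted, since all initial paths start in
    the same state.\<close>
  have init: "path_prefix \<pi> 0 = path_prefix \<pi>' 0"
    if "initial_path ?K \<pi>" "initial_path ?K \<pi>'" for \<pi> \<pi>'
    using that by (simp add: path_prefix_def initial_path_def)
  have sat: "h_sat ?K \<Pi> y 0 (merging_sentence p) \<longleftrightarrow>
    (\<exists>\<alpha><m. \<exists>\<beta><m. P \<alpha> 1 \<and> P \<beta> 2 \<and> (\<forall>t\<ge>3. P \<alpha> t = P \<beta> t))"
    if "initial_path ?K (\<Pi> y)" for \<Pi> y
  proof -
    have "h_sat ?K \<Pi> y 0 (merging_sentence p) \<longleftrightarrow>
      (\<exists>\<pi> \<pi>'. initial_path ?K \<pi> \<and> initial_path ?K \<pi>' \<and> p \<in> val ?K (\<pi> 1) \<and> p \<in> val ?K (\<pi>' 2) \<and>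
        (\<forall>t\<ge>3. (p \<in> val ?K (\<pi> t)) = (p \<in> val ?K (\<pi>' t))))"
      unfolding merging_sentence_def
      by (simp add: h_sat_HGlobally h_sat_HIff numeral_2_eq_2 numeral_3_eq_3) (metis init that)
    moreover have "p \<in> val ?K (lasso L c \<alpha> t) \<longleftrightarrow> P \<alpha> t" for \<alpha> t
      by (simp add: val_bundle[OF assms(1)])
    ultimately show ?thesis
      unfolding initial_path_bundle_iff by metis
  qed
  have "initial_path ?K (lasso L c 0)"
    using assms(2) by (auto simp: initial_path_bundle_iff)
  then have "\<exists>\<Pi> y. (\<forall>x\<in>{0, 1}. initial_path ?K (\<Pi> x)) \<and> y \<in> {0, 1 :: nat}"
    by (intro exI[of _ "\<lambda>_. lasso L c 0"] exI[of _ 0]) simp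
  then show ?thesis
    unfolding h_models_def using sat by blast
qed

text \<open>The bits at times 1 and 2 select lassos 0 and 1. From time 3 on their codes agree, so
  only the shifts can separate them.\<close>

lemma merging_coded_trace_iff:
  assumes "c \<ge> 2" "off 0 = 0" "off 1 \<le> 1"
  shows "(\<exists>\<alpha><c + 2. \<exists>\<beta><c + 2. coded_trace c off \<alpha> 1 \<and> coded_trace c off \<beta> 2 \<and>
      (\<forall>t\<ge>3. coded_trace c off \<alpha> t = coded_trace c off \<beta> t)) \<longleftrightarrow> off 1 = 0"
proof -
  have "off 1 = 0" if *: "\<forall>t\<ge>3. coded_trace c off 0 t = coded_trace c off 1 t"
  proof -
    \<comment> \<open>At this time lasso 0 has completed a full period and shows
      \<open>p\<close>.\<close>
    have "coded_trace c off 0 (c + 2 + c) = coded_trace c off 1 (c + 2 + c)"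
      using * assms(1) by simp
    then have "c dvd c + off 1"
      using assms by (simp add: coded_trace_def split: if_splits)
    then have "c dvd off 1" by simp
    then show ?thesis
      using assms by (auto dest!: dvd_imp_le)
  qed
  moreover have "\<forall>t\<ge>3. coded_trace c off 0 t = coded_trace c off 1 t" if "off 1 = 0"
    using that assms(2) by (auto simp: coded_trace_def)
  moreover have "coded_trace c off \<alpha> 1 \<longleftrightarrow> \<alpha> = 0" "coded_trace c off \<alpha> 2 \<longleftrightarrow> \<alpha> = 1" for \<alpha>
    by (auto simp: coded_trace_def)
  ultimately show ?thesis
    by auto
qed

theorem theorem1:
  fixes AP :: "'p set" and p :: 'p
  assumes "finite AP" and "p \<in> AP"
  shows "\<exists>(VAR :: nat set) (\<phi> :: (nat, 'p) hctl).
    finite VAR \<and> hyperltl_sentence VAR AP \<phi> \<and>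
    (\<forall>(Agts :: nat set) (Obs :: nat \<Rightarrow> 'p set) (\<psi> :: (nat, 'p) kctl).
      finite Agts \<and> (\<forall>a\<in>Agts. Obs a \<subseteq> AP) \<and> kctl_sentence Agts AP \<psi> \<longrightarrow>
      (\<exists>K :: (nat, 'p) kripke.
        finite_kripke_over AP K \<and> \<not> (h_models VAR K \<phi> \<longleftrightarrow> k_models K Obs \<psi>)))"
proof -
  have "\<exists>K :: (nat, 'p) kripke. finite_kripke_over AP K \<and>
      \<not> (h_models {0, 1} K (merging_sentence p) \<longleftrightarrow> k_models K Obs \<psi>)"
    for Obs :: "nat \<Rightarrow> 'p set" and \<psi> :: "(nat, 'p) kctl"
  proof -
    \<comment> \<open>The smallest period that \<open>trace_sat_similar_shifts\<close> admits for
      \<open>\<psi>\<close>.\<close>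
    define c where "c = next_depth \<psi> + 2"
    \<comment> \<open>Only lasso 1 depends on \<open>b\<close>; truncated subtraction gives lasso 0
      shift 0.\<close>
    define off :: "nat \<Rightarrow> nat \<Rightarrow> nat" where "off b \<alpha> = (if \<alpha> = 1 then b else \<alpha> - 2)" for b \<alpha>
    define K where "K b = lasso_bundle p (c + 2) (c + 2) c (coded_trace c (off b))" for b
    have "finite_kripke_over AP (K b)" for b
      unfolding K_def using assms(2) by (intro finite_kripke_over_bundle) (auto simp: c_def)
    moreover have "h_models {0, 1} (K b) (merging_sentence p) \<longleftrightarrow> b = 0" if "b \<le> 1" for b
      using that merging_coded_trace_iff[of c "off b"]
        h_models_merging_bundle[OF lasso_shaped_coded_trace, of "c + 2" p c "off b"]
      by (simp add: K_def c_def off_def)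
    moreover have "k_models (K 0) Obs \<psi> \<longleftrightarrow> k_models (K 1) Obs \<psi>"
    proof -
      have "trace_sat p (c + 2) (coded_trace c (off 0)) Obs \<alpha> 0 \<psi> \<longleftrightarrow>
        trace_sat p (c + 2) (coded_trace c (off 1)) Obs \<alpha> 0 \<psi>" if "\<alpha> < c + 2" for \<alpha>
        by (rule trace_sat_similar_shifts)
          (use that in \<open>auto simp: all_shifts_def similar_shifts_def off_def c_def\<close>)
      then show ?thesis
        unfolding K_def k_models_bundle[OF lasso_shaped_coded_trace] by blast
    qed
    \<comment> \<open>The sentence separates \<open>K 0\<close> from \<open>K 1\<close> and
      \<open>\<psi>\<close> does not, so they disagree on one of the two.\<close>
    ultimately show ?thesis
      by (metis le_numeral_extra(4) zero_le_one zero_neq_one)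
  qed
  then show ?thesis
    using hyperltl_sentence_merging[OF assms(2)]
    by (intro exI[of _ "{0, 1}"] exI[of _ "merging_sentence p"]) auto
qed

end
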